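(* Let $q\ge 1$ be an integer, let $x_0,\dots,x_q\in\mathbb{C}$, let $j\in\{0,\dots,q-1\}$ and let $\beta\ge 0$ be real. Then $$\int_0^\beta e^{-\tau[x_{j+1},\dots,x_q]}\,e^{-(\beta-\tau)[x_0,\dots,x_j]}\,d\tau=-\,e^{-\beta[x_0,\dots,x_q]}.$$
   Context: For a number $t$ and nodes $z_0,\dots,z_m\in\mathbb{C}$, $e^{t[z_0,\dots,z_m]}$ denotes the divided difference $f[z_0,\dots,z_m]$ of the function $f(x)=e^{tx}$ at the nodes $z_0,\dots,z_m$ (not the exponential of a divided difference). Here, for holomorphic $f$, $f[z_0,\dots,z_m]=\frac{1}{2\pi i}\oint_\Gamma\frac{f(z)}{\prod_{i=0}^m(z-z_i)}\,dz$ with $\Gamma$ a positively oriented contour enclosing all the $z_i$; for pairwise distinct nodes this equals $\sum_{i=0}^m f(z_i)/\prod_{k\ne i}(z_i-z_k)$. Nodes may be repeated. *)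

theory Defs
  imports "HOL-Complex_Analysis.Complex_Analysis"
begin

definition positive_contour_around :: "(real \<Rightarrow> complex) \<Rightarrow> complex set \<Rightarrow> bool" where
  "positive_contour_around \<gamma> A \<longleftrightarrow>
     valid_path \<gamma> \<and> simple_path \<gamma> \<and> pathfinish \<gamma> = pathstart \<gamma> \<and>
     A \<subseteq> inside (path_image \<gamma>) \<and> (\<forall>a\<in>inside (path_image \<gamma>). winding_number \<gamma> a = 1)"

text \<open>
  The divided difference of \<open>f\<close> at the nodes \<open>x i\<close> with \<open>i \<in> I\<close>, for finite \<open>I\<close>. A node that occurs
  for several indices is counted with multiplicity, as the product runs over indices.
  The value does not depend on the chosen contour: see \<open>divided_difference_eq\<close> below.
\<close>

definition divided_difference :: "(complex \<Rightarrow> complex) \<Rightarrow> (nat \<Rightarrow> complex) \<Rightarrow> nat set \<Rightarrow> complex" where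
  "divided_difference f x I =
     1 / (2 * of_real pi * \<i>) *
       contour_integral
         (SOME \<gamma>. positive_contour_around \<gamma> (x ` I) \<and>
                  f analytic_on (path_image \<gamma> \<union> inside (path_image \<gamma>)))
         (\<lambda>z. f z / (\<Prod>i\<in>I. z - x i))"

text \<open>The divided difference of \<open>z \<mapsto> exp (t z)\<close>, not the exponential of a divided difference.\<close>

definition exp_divided_difference :: "complex \<Rightarrow> (nat \<Rightarrow> complex) \<Rightarrow> nat set \<Rightarrow> complex" where
  "exp_divided_difference t x I = divided_difference (\<lambda>z. exp (t * z)) x I"

lemma contour_integral_positive_contour_around:
  fixes x :: "nat \<Rightarrow> complex"
  assumes I: "finite I" and g: "positive_contour_around \<gamma> (x ` I)"
    and f: "f analytic_on (path_image \<gamma> \<union> inside (path_image \<gamma>))"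
  shows "contour_integral \<gamma> (\<lambda>z. f z / (\<Prod>i\<in>I. z - x i)) =
           2 * of_real pi * \<i> * (\<Sum>p\<in>x ` I. residue (\<lambda>z. f z / (\<Prod>i\<in>I. z - x i)) p)"
proof -
  let ?P = "path_image \<gamma>"
  from g have vp: "valid_path \<gamma>" and sp: "simple_path \<gamma>" and loop: "pathfinish \<gamma> = pathstart \<gamma>"
    and sub: "x ` I \<subseteq> inside ?P" and wn: "\<And>a. a \<in> inside ?P \<Longrightarrow> winding_number \<gamma> a = 1"
    by (auto simp: positive_contour_around_def)
  obtain T where T: "open T" "?P \<union> inside ?P \<subseteq> T" "f holomorphic_on T"
    using f analytic_on_holomorphic by blast
  have J: "inside ?P \<noteq> {}" "connected (inside ?P)" "frontier (inside ?P) = ?P"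
    using Jordan_inside_outside[OF sp loop] by auto
  have "closure (inside ?P) = ?P \<union> inside ?P"
    using J closure_Un_frontier by blast
  then have conn: "connected (?P \<union> inside ?P)"
    using connected_imp_connected_closure[OF J(2)] by simp
  obtain a where a: "a \<in> inside ?P" using J by blast
  define S where "S = connected_component_set T a"
  have S: "open S" "connected S" "S \<subseteq> T"
    using T by (auto simp: S_def open_connected_component connected_component_subset)
  have PS: "?P \<union> inside ?P \<subseteq> S"
    unfolding S_def using a conn T by (intro connected_component_maximal) auto
  have "contour_integral \<gamma> (\<lambda>z. f z / (\<Prod>i\<in>I. z - x i)) =
     2 * pi * \<i> * (\<Sum>p\<in>x ` I. winding_number \<gamma> p * residue (\<lambda>z. f z / (\<Prod>i\<in>I. z - x i)) p)"
  proof (rule Residue_theorem[OF S(1,2) _ _ vp loop])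
    show "(\<lambda>z. f z / (\<Prod>i\<in>I. z - x i)) holomorphic_on S - x ` I"
      using I S T by (intro holomorphic_intros) (auto intro: holomorphic_on_subset)
    show "?P \<subseteq> S - x ` I"
      using PS sub inside_no_overlap[of ?P] by blast
    show "\<forall>z. z \<notin> S \<longrightarrow> winding_number \<gamma> z = 0"
    proof (intro allI impI)
      fix z assume "z \<notin> S"
      then have "z \<in> outside ?P" using PS inside_Un_outside[of ?P] by blast
      then show "winding_number \<gamma> z = 0"
        using winding_number_zero_in_outside valid_path_imp_path[OF vp] loop by blast
    qed
  qed (use I in auto)
  also have "(\<Sum>p\<in>x ` I. winding_number \<gamma> p * residue (\<lambda>z. f z / (\<Prod>i\<in>I. z - x i)) p) =
     (\<Sum>p\<in>x ` I. residue (\<lambda>z. f z / (\<Prod>i\<in>I. z - x i)) p)"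
    using sub wn by (intro sum.cong) auto
  finally show ?thesis by simp
qed

lemma divided_difference_eq:
  assumes I: "finite I" and g: "positive_contour_around \<gamma> (x ` I)"
    and f: "f analytic_on (path_image \<gamma> \<union> inside (path_image \<gamma>))"
  shows "divided_difference f x I =
           1 / (2 * of_real pi * \<i>) * contour_integral \<gamma> (\<lambda>z. f z / (\<Prod>i\<in>I. z - x i))"
proof -
  let ?Q = "\<lambda>\<gamma>. positive_contour_around \<gamma> (x ` I) \<and> f analytic_on (path_image \<gamma> \<union> inside (path_image \<gamma>))"
  have Q: "?Q (SOME \<gamma>. ?Q \<gamma>)" by (rule someI[of ?Q \<gamma>]) (use g f in simp)
  have "contour_integral (SOME \<gamma>. ?Q \<gamma>) (\<lambda>z. f z / (\<Prod>i\<in>I. z - x i)) =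
      contour_integral \<gamma> (\<lambda>z. f z / (\<Prod>i\<in>I. z - x i))"
    using contour_integral_positive_contour_around[OF I g f]
      contour_integral_positive_contour_around[OF I conjunct1[OF Q] conjunct2[OF Q]]
    by (rule trans[OF _ sym, rotated])
  then show ?thesis
    unfolding divided_difference_def by (rule arg_cong)
qed

lemma positive_contour_around_circlepath:
  assumes "r > 0" "A \<subseteq> ball c r"
  shows "positive_contour_around (circlepath c r) A"
proof -
  have "inside (sphere c r) = ball c r"
    using inside_frontier_eq_interior[of "cball c r"] assms by simp
  then show ?thesis
    using assms by (auto simp: positive_contour_around_def simple_path_circlepath
        winding_number_circlepath dist_norm norm_minus_commute)
qed

lemma divided_difference_circlepath:
  assumes "finite I" "r > 0" "x ` I \<subseteq> ball c r" "f analytic_on cball c r"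
  shows "divided_difference f x I =
           1 / (2 * of_real pi * \<i>) * contour_integral (circlepath c r) (\<lambda>z. f z / (\<Prod>i\<in>I. z - x i))"
proof (rule divided_difference_eq)
  have "inside (sphere c r) = ball c r"
    using inside_frontier_eq_interior[of "cball c r"] assms by simp
  then have "path_image (circlepath c r) \<union> inside (path_image (circlepath c r)) = cball c r"
    using assms by auto
  then show "f analytic_on (path_image (circlepath c r) \<union> inside (path_image (circlepath c r)))"
    using assms by simp
qed (use assms positive_contour_around_circlepath in auto)

lemma divided_difference_distinct:
  assumes I: "finite I" and f: "f holomorphic_on UNIV" and inj: "inj_on x I"
  shows "divided_difference f x I = (\<Sum>i\<in>I. f (x i) / (\<Prod>k\<in>I - {i}. x i - x k))"
proof -
  obtain r where r: "r > 0" "x ` I \<subseteq> ball 0 r"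
    using I bounded_subset_ballD[of "x ` I" 0] finite_imp_bounded by blast
  have an: "f analytic_on X" for X
    using f analytic_on_open[of UNIV f] analytic_on_subset[of f UNIV X] by simp
  let ?F = "\<lambda>z. f z / (\<Prod>i\<in>I. z - x i)"
  have res: "residue ?F (x i) = f (x i) / (\<Prod>k\<in>I - {i}. x i - x k)" if i: "i \<in> I" for i
  proof -
    let ?g = "\<lambda>z. f z / (\<Prod>k\<in>I - {i}. z - x k)"
    have op: "open (- x ` (I - {i}))" using I by (simp add: finite_imp_closed open_Compl)
    have hol: "?g holomorphic_on - x ` (I - {i})"
      using I f by (intro holomorphic_intros) (auto intro: holomorphic_on_subset)
    have mem: "x i \<in> - x ` (I - {i})" using inj i by (auto simp: inj_on_def)
    have "?F = (\<lambda>w. ?g w / (w - x i))"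
      by (simp only: prod.remove[OF I i] divide_divide_eq_left mult.commute)
    then show ?thesis using residue_simple[OF op mem hol] by simp
  qed
  have "divided_difference f x I = (\<Sum>p\<in>x ` I. residue ?F p)"
    using divided_difference_eq[OF I positive_contour_around_circlepath[OF r] an]
      contour_integral_positive_contour_around[OF I positive_contour_around_circlepath[OF r] an]
    by simp
  also have "\<dots> = (\<Sum>i\<in>I. residue ?F (x i))"
    using inj by (simp add: sum.reindex)
  finally show ?thesis using res by simp
qed

end

theory Submission
  imports Defs
begin

text \<open>
  Write \<open>a k t\<close> and \<open>d k t\<close> for the divided differences of \<open>z \<mapsto> exp (- t z)\<close> at the nodes
  \<open>x 0, \<dots>, x k\<close> and \<open>x k, \<dots>, x q\<close>, and set \<open>a (-1) = 0\<close>. Since \<open>z / (z - x k) = 1 + x k / (z - x k)\<close>,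
  differentiation in \<open>t\<close> gives \<open>a k' = - x k * a k - a (k - 1)\<close> and \<open>d k' = - x k * d k - d (k + 1)\<close>.
  Hence \<open>G \<tau> = (\<Sum>k\<le>j. a k (\<beta> - \<tau>) * d k \<tau>)\<close>, a truncation of the Leibniz rule for
  \<open>exp (- \<beta> z) = exp (- (\<beta> - \<tau>) z) * exp (- \<tau> z)\<close>, has the telescoping derivative
  \<open>- a j (\<beta> - \<tau>) * d (j + 1) \<tau>\<close>. At \<open>t = 0\<close> all divided differences with at least two
  nodes vanish, so \<open>G 0 = 0\<close> and \<open>G \<beta> = d 0 \<beta>\<close>.
\<close>

lemma finite_image_subset_ball_0:
  fixes x :: "'b \<Rightarrow> 'a::real_normed_vector"
  assumes "finite I"
  obtains r where "r > 0" "x ` I \<subseteq> ball 0 r"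
  using assms bounded_subset_ballD[of "x ` I" 0] finite_imp_bounded by blast

text \<open>An entire \<open>f\<close> is analytic on every closed disc, so any circle around the
  nodes may serve as contour. Later proofs use this to put several node sets inside one circle or to
  let the radius grow.\<close>

lemma divided_difference_entire:
  assumes "finite I" "f holomorphic_on UNIV" "r > 0" "x ` I \<subseteq> ball c r"
  shows "divided_difference f x I =
           1 / (2 * of_real pi * \<i>) * contour_integral (circlepath c r) (\<lambda>z. f z / (\<Prod>i\<in>I. z - x i))"
  using assms analytic_on_open[of UNIV f] analytic_on_subset[of f UNIV]
  by (intro divided_difference_circlepath) auto

lemma contour_integrable_divided_difference:
  assumes "finite I" "f holomorphic_on UNIV" "r > 0" "x ` I \<subseteq> ball c r"
  shows "(\<lambda>z. f z / (\<Prod>i\<in>I. z - x i)) contour_integrable_on circlepath c r"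
proof (rule contour_integrable_continuous_circlepath)
  have "(\<Prod>i\<in>I. z - x i) \<noteq> 0" if "z \<in> sphere c r" for z
    using assms that by (auto simp: image_subset_iff)
  then show "continuous_on (path_image (circlepath c r)) (\<lambda>z. f z / (\<Prod>i\<in>I. z - x i))"
    using assms holomorphic_on_imp_continuous_on[of f UNIV]
    by (intro continuous_intros) (auto intro: continuous_on_subset)
qed

text \<open>Without nodes the integrand is \<open>f\<close> itself, so Cauchy's theorem applies.
  This is the boundary value \<open>a (-1) = 0\<close> of the recursion.\<close>

lemma divided_difference_empty:
  assumes "f holomorphic_on UNIV"
  shows "divided_difference f x {} = 0"
proof -
  have "(f has_contour_integral 0) (circlepath 0 1)"
    by (rule Cauchy_theorem_convex_simple[OF assms]) auto
  then show ?thesis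
    using divided_difference_entire[of "{}" f 1 x 0] assms by (simp add: contour_integral_unique)
qed

lemma divided_difference_singleton:
  assumes "f holomorphic_on UNIV"
  shows "divided_difference f x {i} = f (x i)"
  using divided_difference_distinct[of "{i}" f x] assms by simp

text \<open>Under the integral over one common circle write \<open>z = x i + (z - x i)\<close>; the
  second summand cancels the factor of index \<open>i\<close>. Repeated nodes cause no trouble,
  since the product runs over indices.\<close>

lemma divided_difference_mult_ident:
  assumes "finite I" "i \<notin> I" and f: "f holomorphic_on UNIV"
  shows "divided_difference (\<lambda>z. z * f z) x (insert i I) =
           x i * divided_difference f x (insert i I) + divided_difference f x I"
proof -
  obtain r where r: "r > 0" "x ` insert i I \<subseteq> ball 0 r"
    using finite_image_subset_ball_0[of "insert i I" x] assms by blast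
  let ?C = "circlepath 0 r"
  have fin: "finite (insert i I)" and sub: "x ` I \<subseteq> ball 0 r" using assms r by auto
  have zf: "(\<lambda>z. z * f z) holomorphic_on UNIV"
    using f by (intro holomorphic_intros)
  note int1 = contour_integrable_divided_difference[OF fin f r]
  note int2 = contour_integrable_divided_difference[OF assms(1) f r(1) sub]
  have "contour_integral ?C (\<lambda>z. z * f z / (\<Prod>i\<in>insert i I. z - x i)) =
    contour_integral ?C (\<lambda>z. x i * (f z / (\<Prod>i\<in>insert i I. z - x i)) + f z / (\<Prod>i\<in>I. z - x i))"
  proof (rule contour_integral_cong)
    fix z assume "z \<in> path_image ?C"
    then have "z - x i \<noteq> 0" using r by auto
    then have "f z / (\<Prod>i\<in>I. z - x i) = (z - x i) * f z / (\<Prod>i\<in>insert i I. z - x i)"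
      using assms by simp
    then show "z * f z / (\<Prod>i\<in>insert i I. z - x i) =
      x i * (f z / (\<Prod>i\<in>insert i I. z - x i)) + f z / (\<Prod>i\<in>I. z - x i)"
      by (simp add: algebra_simps diff_divide_distrib)
  qed simp
  also have "\<dots> = x i * contour_integral ?C (\<lambda>z. f z / (\<Prod>i\<in>insert i I. z - x i)) +
      contour_integral ?C (\<lambda>z. f z / (\<Prod>i\<in>I. z - x i))"
    by (simp only: contour_integral_add[OF contour_integrable_lmul[OF int1] int2]
        contour_integral_lmul[OF int1])
  finally show ?thesis
    unfolding divided_difference_entire[OF fin zf r] divided_difference_entire[OF fin f r]
      divided_difference_entire[OF assms(1) f r(1) sub]
    by (simp add: field_simps)
qed

text \<open>With at least two nodes the integrand is of order at most \<open>R ^ (-2)\<close> on a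
  circle of radius \<open>R\<close>, so the integral is O(\<open>1 / R\<close>), while its value
  does not depend on \<open>R\<close>.\<close>

lemma divided_difference_const_eq_0:
  assumes fin: "finite I" and card: "card I \<ge> 2"
  shows "divided_difference (\<lambda>z. c) x I = 0"
proof -
  obtain r where r: "r > 0" "x ` I \<subseteq> ball 0 r"
    using finite_image_subset_ball_0[OF fin] by blast
  \<comment> \<open>Since \<open>R / 2 > r\<close>, every node has distance at least
    \<open>R / 2\<close> from the circle; since \<open>R / 2 \<ge> 1\<close>, the exponent
    \<open>card I\<close> may be lowered to 2.\<close>
  have bound: "norm (divided_difference (\<lambda>z. c) x I) \<le> 4 * norm c / R" if R: "R \<ge> 2 * r + 2" for R
  proof -
    have R': "R > 0" "x ` I \<subseteq> ball 0 R" using r R by auto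
    have "norm (c / (\<Prod>i\<in>I. z - x i)) \<le> norm c / (R / 2) ^ 2" if z: "norm (z - 0) = R" for z
    proof -
      have "R / 2 \<le> norm (z - x i)" if "i \<in> I" for i
        using r R z that norm_triangle_ineq2[of z "x i"] by force
      then have "(\<Prod>i\<in>I. R / 2) \<le> (\<Prod>i\<in>I. norm (z - x i))"
        using R' by (intro prod_mono) auto
      moreover have "(R / 2) ^ 2 \<le> (R / 2) ^ card I"
        using card R r by (intro power_increasing) auto
      ultimately have "(R / 2) ^ 2 \<le> norm (\<Prod>i\<in>I. z - x i)"
        by (simp add: prod_norm)
      then show ?thesis
        unfolding norm_divide using R' by (intro divide_left_mono mult_pos_pos) (auto intro: less_le_trans[rotated])
    qed
    then have "norm (contour_integral (circlepath 0 R) (\<lambda>z. c / (\<Prod>i\<in>I. z - x i)))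
        \<le> norm c / (R / 2) ^ 2 * (2 * pi * R)"
      using R' contour_integrable_divided_difference[OF fin _ R', of "\<lambda>z. c"]
      by (intro has_contour_integral_bound_circlepath[OF has_contour_integral_integral]) auto
    then show ?thesis
      unfolding divided_difference_entire[OF fin holomorphic_on_const R'] using R'
      by (simp add: norm_mult norm_divide field_simps power2_eq_square)
  qed
  have "((\<lambda>R. 4 * norm c / R) \<longlongrightarrow> 0) at_top"
    by (intro tendsto_divide_0[OF tendsto_const] filterlim_at_top_imp_at_infinity filterlim_ident)
  then have "norm (divided_difference (\<lambda>z. c) x I) \<le> 0"
    using bound by (intro tendsto_lowerbound[where F = at_top])
      (auto intro: eventually_at_top_linorderI)
  then show ?thesis by simp
qed

text \<open>The circle depends on the nodes only, not on \<open>t\<close>, so one may differentiate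
  under the integral sign.\<close>

lemma has_field_derivative_exp_divided_difference:
  assumes fin: "finite I"
  shows "((\<lambda>t. exp_divided_difference t x I) has_field_derivative
            divided_difference (\<lambda>z. z * exp (t * z)) x I) (at t)"
proof -
  obtain r where r: "r > 0" "x ` I \<subseteq> ball 0 r"
    using finite_image_subset_ball_0[OF fin] by blast
  define p where "p = circlepath 0 r"
  \<comment> \<open>\<open>w\<close> collects the part of the parametrized integrand that is free of
    \<open>t\<close>; only its continuity matters for the Leibniz rule.\<close>
  define w where "w u = vector_derivative p (at u) / (\<Prod>i\<in>I. p u - x i)" for u
  have hol: "(\<lambda>z. exp (s * z)) holomorphic_on UNIV" "(\<lambda>z. z * exp (s * z)) holomorphic_on UNIV" for s
    by (intro holomorphic_intros)+
  have dd: "divided_difference f x I = 1 / (2 * of_real pi * \<i>) * integral (cbox 0 1) (\<lambda>u. f (p u) * w u)"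
    if "f holomorphic_on UNIV" for f
    unfolding divided_difference_entire[OF fin that r] contour_integral_integral w_def p_def
    by simp
  have nz: "(\<Prod>i\<in>I. p u - x i) \<noteq> 0" for u
  proof -
    have "p u \<in> sphere 0 r"
      using r by (simp add: p_def circlepath norm_mult)
    then show ?thesis using r fin by auto
  qed
  have cp: "continuous_on A p" for A
    unfolding p_def circlepath by (intro continuous_intros)
  have cw: "continuous_on (cbox 0 1) w"
  proof -
    have "continuous_on (cbox 0 1) (\<lambda>u. 2 * pi * \<i> * r * exp (2 * of_real pi * \<i> * of_real u) / (\<Prod>i\<in>I. p u - x i))"
      using nz by (intro continuous_intros cp) auto
    then show ?thesis
      by (rule continuous_on_eq) (simp add: w_def p_def vector_derivative_circlepath)
  qed
  have "((\<lambda>s. integral (cbox 0 1) (\<lambda>u. exp (s * p u) * w u)) has_field_derivative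
      integral (cbox 0 1) (\<lambda>u. p u * exp (t * p u) * w u)) (at t within UNIV)"
  proof (rule leibniz_rule_field_derivative)
    show "((\<lambda>s. exp (s * p u) * w u) has_field_derivative p u * exp (s * p u) * w u) (at s within UNIV)"
      for s u
      by (auto intro!: derivative_eq_intros)
    show "(\<lambda>u. exp (s * p u) * w u) integrable_on cbox 0 1" for s
      by (intro integrable_continuous continuous_intros cp cw)
    show "continuous_on (UNIV \<times> cbox 0 1) (\<lambda>(s, u). p u * exp (s * p u) * w u)"
      unfolding split_def
      by (intro continuous_intros continuous_on_compose2[OF cw continuous_on_snd]
          continuous_on_compose2[OF cp[of UNIV] continuous_on_snd]) auto
  qed auto
  then show ?thesis
    unfolding exp_divided_difference_def dd[OF hol(1)] dd[OF hol(2)] by (intro DERIV_cmult)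
qed

text \<open>Working with index sets covers both recursions at once: for \<open>a k\<close> the last
  index is inserted, for \<open>d k\<close> the first.\<close>

lemma has_vector_derivative_exp_divided_difference_insert:
  assumes "finite I" "i \<notin> I"
  shows "((\<lambda>t. exp_divided_difference (- of_real t) x (insert i I)) has_vector_derivative
            - (x i * exp_divided_difference (- of_real t) x (insert i I) +
               exp_divided_difference (- of_real t) x I)) (at t within S)"
proof -
  have "((\<lambda>t. - complex_of_real t) has_vector_derivative - 1) (at t within S)"
    by (auto intro!: derivative_eq_intros)
  moreover have "divided_difference (\<lambda>z. z * exp (- of_real t * z)) x (insert i I) =
      x i * exp_divided_difference (- of_real t) x (insert i I) + exp_divided_difference (- of_real t) x I"
    unfolding exp_divided_difference_def
    by (rule divided_difference_mult_ident[OF assms]) (intro holomorphic_intros)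
  then have "((\<lambda>t. exp_divided_difference t x (insert i I)) has_field_derivative
      x i * exp_divided_difference (- of_real t) x (insert i I) + exp_divided_difference (- of_real t) x I)
      (at (- of_real t) within (\<lambda>t. - of_real t) ` S)"
    using has_field_derivative_exp_divided_difference[of "insert i I" x "- of_real t"] assms
    by (auto intro: has_field_derivative_at_within)
  ultimately show ?thesis
    using field_vector_diff_chain_within by (fastforce simp: o_def)
qed

lemma exp_divided_difference_0:
  assumes "finite I"
  shows "exp_divided_difference 0 x I = (if card I = 1 then 1 else 0)"
proof -
  consider "card I = 0" | "card I = 1" | "card I \<ge> 2" by linarith
  then show ?thesis
  proof cases
    case 1
    then show ?thesis
      using assms by (simp add: exp_divided_difference_def divided_difference_empty)
  next
    case 2
    then show ?thesis
      by (auto simp: card_1_singleton_iff exp_divided_difference_def divided_difference_singleton)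
  next
    case 3
    then show ?thesis
      using assms by (simp add: exp_divided_difference_def divided_difference_const_eq_0)
  qed
qed

theorem theorem5:
  fixes q j :: nat and x :: "nat \<Rightarrow> complex" and \<beta> :: real
  assumes "q \<ge> 1" and "j \<in> {0..q - 1}" and "\<beta> \<ge> 0"
  shows "((\<lambda>\<tau>. exp_divided_difference (- of_real \<tau>) x {j + 1..q} *
                exp_divided_difference (- of_real (\<beta> - \<tau>)) x {0..j})
           has_integral - exp_divided_difference (- of_real \<beta>) x {0..q}) {0..\<beta>}"
proof -
  let ?E = "\<lambda>t. exp_divided_difference (- of_real t) x"
  \<comment> \<open>Writing \<open>{0..<Suc k}\<close> for the nodes of \<open>a k\<close> makes
    \<open>a (k - 1)\<close> belong to \<open>{0..<k}\<close>, which is empty for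
    \<open>k = 0\<close>.\<close>
  define G where "G \<tau> = (\<Sum>k<Suc j. ?E (\<beta> - \<tau>) {0..<Suc k} * ?E \<tau> {k..q})" for \<tau>
  have jq: "j < q" using assms by auto
  have left: "((\<lambda>\<tau>. ?E (\<beta> - \<tau>) {0..<Suc k}) has_vector_derivative
      x k * ?E (\<beta> - \<tau>) {0..<Suc k} + ?E (\<beta> - \<tau>) {0..<k}) (at \<tau>)" for k \<tau>
  proof -
    have "((\<lambda>\<tau>. \<beta> - \<tau>) has_vector_derivative - 1) (at \<tau>)"
      by (auto intro!: derivative_eq_intros)
    from vector_diff_chain_at[OF this has_vector_derivative_exp_divided_difference_insert[of "{0..<k}" k x]]
    show ?thesis by (simp add: o_def atLeast0_lessThan_Suc add.commute)
  qed
  \<comment> \<open>The bound on \<open>k\<close> gives \<open>k \<le> q\<close>, so that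
    \<open>{k..q}\<close> really arises by inserting \<open>k\<close>.\<close>
  have right: "((\<lambda>\<tau>. ?E \<tau> {k..q}) has_vector_derivative
      - (x k * ?E \<tau> {k..q} + ?E \<tau> {Suc k..q})) (at \<tau>)" if "k < Suc j" for k \<tau>
    using has_vector_derivative_exp_divided_difference_insert[of "{Suc k..q}" k x] that jq
    by (simp add: atLeastAtMost_insertL)
  have deriv: "(G has_vector_derivative - (?E \<tau> {j + 1..q} * ?E (\<beta> - \<tau>) {0..j})) (at \<tau>)" for \<tau>
  proof -
    \<comment> \<open>\<open>?h k\<close> cuts the nodes just before index \<open>k\<close>. The
      reflection in \<open>left\<close> reverses the sign of its \<open>x k\<close> term, which
      therefore cancels against that of \<open>right\<close> and leaves
      \<open>?h k - ?h (Suc k)\<close>.\<close>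
    let ?h = "\<lambda>k. ?E (\<beta> - \<tau>) {0..<k} * ?E \<tau> {k..q}"
    have "(G has_vector_derivative (\<Sum>k<Suc j.
        ?E (\<beta> - \<tau>) {0..<Suc k} * - (x k * ?E \<tau> {k..q} + ?E \<tau> {Suc k..q}) +
        (x k * ?E (\<beta> - \<tau>) {0..<Suc k} + ?E (\<beta> - \<tau>) {0..<k}) * ?E \<tau> {k..q})) (at \<tau>)"
      unfolding G_def
      by (intro has_vector_derivative_sum has_vector_derivative_mult left right) auto
    also have "(\<Sum>k<Suc j.
        ?E (\<beta> - \<tau>) {0..<Suc k} * - (x k * ?E \<tau> {k..q} + ?E \<tau> {Suc k..q}) +
        (x k * ?E (\<beta> - \<tau>) {0..<Suc k} + ?E (\<beta> - \<tau>) {0..<k}) * ?E \<tau> {k..q}) =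
      (\<Sum>k<Suc j. ?h k - ?h (Suc k))"
      by (intro sum.cong) (auto simp: algebra_simps)
    also have "\<dots> = ?h 0 - ?h (Suc j)"
      by (rule sum_lessThan_telescope')
    also have "?h 0 = 0"
      by (simp add: exp_divided_difference_def divided_difference_empty holomorphic_intros)
    finally show ?thesis
      by (simp add: atLeastLessThanSuc_atLeastAtMost mult.commute)
  qed
  \<comment> \<open>Here \<open>k \<le> j < q\<close>, so each second factor is taken at time 0 with
    at least two nodes.\<close>
  have G0: "G 0 = 0"
    unfolding G_def using jq by (intro sum.neutral) (auto simp: exp_divided_difference_0)
  \<comment> \<open>Now the first factors are taken at time 0 with \<open>k + 1\<close> nodes: only
    \<open>k = 0\<close> survives, with factor 1.\<close>
  have G\<beta>: "G \<beta> = ?E \<beta> {0..q}"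
    unfolding G_def by (subst sum.lessThan_Suc_shift) (simp add: exp_divided_difference_0)
  have "((\<lambda>\<tau>. - (?E \<tau> {j + 1..q} * ?E (\<beta> - \<tau>) {0..j})) has_integral (G \<beta> - G 0)) {0..\<beta>}"
    using assms deriv
    by (intro fundamental_theorem_of_calculus) (auto intro: has_vector_derivative_at_within)
  from has_integral_neg[OF this] show ?thesis
    by (simp add: G0 G\<beta>)
qed

end
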